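(* Let $\Theta$, $X$, $T$ be the type, decision and test spaces, $u$ the agent's utility and $\pi\colon T\times\Theta\to[0,1]$ the passage rate. Fix a type $\theta\in\Theta$ and tests $\tau,\psi\in T$ such that $\tau\succeq_\theta\psi$ (i.e. $\tau$ is more $\theta$-discerning than $\psi$). If a social choice function $f\colon\Theta\to\Delta(X)$ is canonically implemented by a canonical mechanism $(t,g)$ in which $t(\theta)=\psi$ (i.e. $t(\theta)$ is the point mass on $\psi$), then $f$ is also canonically implemented by some canonical mechanism $(t',g')$ in which $t'(\theta)=\tau$ (i.e. $t'(\theta)$ is the point mass on $\tau$).
   Context: **Setting.** $\Theta$ (types), $X$ (decisions) and $T$ (pass–fail tests) are nonempty Polish spaces. $\Delta(Y)$ denotes the set of probability measures on $Y$. The agent has a bounded Borel measurable utility $u\colon X\times\Theta\to\mathbb{R}$, extended linearly to $\Delta(X)\times\Theta$. The passage rate $\pi\colon T\times\Theta\to[0,1]$, written $\pi(\tau|\theta)$, is Borel measurable: if type $\theta$ tries on test $\tau$ he passes (score $1$) with probability $\pi(\tau|\theta)$ and otherwise fails (score $0$); if he does not try he gets score $0$ with certainty. Trying is costless. All maps and probability kernels in mechanisms, strategies and social choice functions are universally measurable (measurable with respect to the universal completions of the Borel $\sigma$-algebras). **Canonical mechanisms.** A canonical mechanism is a pair $(t,g)$ with a testing rule $t\colon\Theta\to\Delta(T)$ and an outcome rule $g\colon\Theta\times T\times\{0,1\}\to\Delta(X)$. A strategy is a pair $(r,a)$ with $r\colon\Theta\to\Delta(\Theta)$ (report) and $a\colon\Theta\times\Theta\times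 T\to[0,1]$ (probability of trying given true type, report and test). Play by type $\theta$: a report $\theta'\sim r(\theta)$ is sent; a test $\tau\sim t(\theta')$ is drawn and shown to the agent; the agent tries with probability $a(\theta,\theta',\tau)$; hence the score is $s=1$ with probability $a(\theta,\theta',\tau)\pi(\tau|\theta)$ and $s=0$ otherwise; a decision $x\sim g(\theta',\tau,s)$ is drawn. A strategy is a best response if for every type $\theta$ it maximizes type $\theta$'s expected utility over all strategies. **Canonical implementation.** A social choice function is a map $f\colon\Theta\to\Delta(X)$. The mechanism $(t,g)$ canonically implements $f$ if there is a strategy $(r,a)$ with $r$ the identity (truthful reporting) and $a(\theta,\theta,\tau)=1$ for all $\theta\in\Theta$ and all $\tau\in\operatorname{supp}t(\theta)$, such that $(r,a)$ is a best response and, for each type $\theta$, the induced distribution of the decision is $f(\theta)$. **$\theta$-discernment.** For a type $\theta$ and tests $\tau,\psi$, write $\tau\succeq_\theta\psi$ ("$\tau$ is more $\theta$-discerning than $\psi$") if there exist $k_0,k_1\in[0,1]$ with $k_1\ge k_0$ such that (i) $\pi(\tau|\theta)k_1+(1-\pi(\tau|\theta))k_0=\pi(\psi|\theta)$, and (ii) $\pi(\tau|\theta')k_1+(1-\pi(\tau|\theta'))k_0\le\pi(\psi|\theta')$ for all types $\theta'\neq\theta$. *)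

theory Defs
  imports "HOL-Probability.Probability"
begin

definition universal_completion :: "'a measure \<Rightarrow> 'a measure" where
  "universal_completion M = sigma (space M)
     {A. A \<subseteq> space M \<and>
         (\<forall>\<mu>. prob_space \<mu> \<and> sets \<mu> = sets M \<longrightarrow> A \<in> sets (completion \<mu>))}"

text \<open>
  The measurable sets of \<open>prob_algebra borel\<close> are generated by the evaluations
  \<open>\<mu> \<mapsto> \<mu> B\<close> with \<open>B\<close> Borel, so this says that \<open>k\<close> takes values in the Borel
  probability measures and \<open>y \<mapsto> k y B\<close> is universally measurable for every Borel set \<open>B\<close>.
\<close>
definition univ_kernel :: "('a::topological_space \<Rightarrow> 'b::topological_space measure) \<Rightarrow> bool" where
  "univ_kernel k \<longleftrightarrow> k \<in> universal_completion borel \<rightarrow>\<^sub>M prob_algebra borel"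

definition msupport :: "'a::topological_space measure \<Rightarrow> 'a set" where
  "msupport \<mu> = {y. \<forall>U. open U \<and> y \<in> U \<longrightarrow> emeasure \<mu> U > 0}"

text \<open>
  Argument order: \<open>\<pi> \<tau> \<theta>\<close> is the passage rate of type \<open>\<theta>\<close> on test \<open>\<tau>\<close>;
  \<open>g \<theta>' \<tau> s\<close> takes report, test and score, where \<open>s = True\<close> is a pass (score 1);
  \<open>a \<theta> \<theta>' \<tau>\<close> takes true type, report and test.
\<close>

definition canonical_mechanism ::
  "('th::polish_space \<Rightarrow> 't::polish_space measure) \<Rightarrow>
   ('th \<Rightarrow> 't \<Rightarrow> bool \<Rightarrow> 'x::polish_space measure) \<Rightarrow> bool" where
  "canonical_mechanism t g \<longleftrightarrow> univ_kernel t \<and> univ_kernel (\<lambda>(\<theta>', \<tau>, s). g \<theta>' \<tau> s)"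

definition strategy ::
  "('th::polish_space \<Rightarrow> 'th measure) \<Rightarrow> ('th \<Rightarrow> 'th \<Rightarrow> 't::polish_space \<Rightarrow> real) \<Rightarrow> bool" where
  "strategy r a \<longleftrightarrow> univ_kernel r
     \<and> (\<lambda>(\<theta>, \<theta>', \<tau>). a \<theta> \<theta>' \<tau>) \<in> universal_completion borel \<rightarrow>\<^sub>M borel
     \<and> (\<forall>\<theta> \<theta>' \<tau>. a \<theta> \<theta>' \<tau> \<in> {0..1})"

text \<open>
  The integrands below are only universally measurable, so the measures \<open>r \<theta>\<close> and \<open>t \<theta>'\<close>
  are completed before binding (\<open>Giry_Monad.bind\<close> and the Bochner integral are meaningful only
  for measurable functions). The result is again a measure on the Borel sets.
\<close>
definition decision_law ::
  "('t::polish_space \<Rightarrow> 'th::polish_space \<Rightarrow> real) \<Rightarrow>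
   ('th \<Rightarrow> 't measure) \<Rightarrow> ('th \<Rightarrow> 't \<Rightarrow> bool \<Rightarrow> 'x::polish_space measure) \<Rightarrow>
   ('th \<Rightarrow> 'th measure) \<Rightarrow> ('th \<Rightarrow> 'th \<Rightarrow> 't \<Rightarrow> real) \<Rightarrow> 'th \<Rightarrow> 'x measure" where
  "decision_law \<pi> t g r a \<theta> =
     Giry_Monad.bind (completion (r \<theta>)) (\<lambda>\<theta>'.
       Giry_Monad.bind (completion (t \<theta>')) (\<lambda>\<tau>.
         Giry_Monad.bind (measure_pmf (bernoulli_pmf (a \<theta> \<theta>' \<tau> * \<pi> \<tau> \<theta>))) (\<lambda>s. g \<theta>' \<tau> s)))"

definition expected_utility ::
  "('x::polish_space \<Rightarrow> 'th::polish_space \<Rightarrow> real) \<Rightarrow> ('t::polish_space \<Rightarrow> 'th \<Rightarrow> real) \<Rightarrow>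
   ('th \<Rightarrow> 't measure) \<Rightarrow> ('th \<Rightarrow> 't \<Rightarrow> bool \<Rightarrow> 'x measure) \<Rightarrow>
   ('th \<Rightarrow> 'th measure) \<Rightarrow> ('th \<Rightarrow> 'th \<Rightarrow> 't \<Rightarrow> real) \<Rightarrow> 'th \<Rightarrow> real" where
  "expected_utility u \<pi> t g r a \<theta> = (\<integral>x. u x \<theta> \<partial>decision_law \<pi> t g r a \<theta>)"

definition best_response ::
  "('x::polish_space \<Rightarrow> 'th::polish_space \<Rightarrow> real) \<Rightarrow> ('t::polish_space \<Rightarrow> 'th \<Rightarrow> real) \<Rightarrow>
   ('th \<Rightarrow> 't measure) \<Rightarrow> ('th \<Rightarrow> 't \<Rightarrow> bool \<Rightarrow> 'x measure) \<Rightarrow>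
   ('th \<Rightarrow> 'th measure) \<Rightarrow> ('th \<Rightarrow> 'th \<Rightarrow> 't \<Rightarrow> real) \<Rightarrow> bool" where
  "best_response u \<pi> t g r a \<longleftrightarrow> strategy r a
     \<and> (\<forall>\<theta> r' a'. strategy r' a' \<longrightarrow>
          expected_utility u \<pi> t g r' a' \<theta> \<le> expected_utility u \<pi> t g r a \<theta>)"

definition canonically_implements ::
  "('x::polish_space \<Rightarrow> 'th::polish_space \<Rightarrow> real) \<Rightarrow> ('t::polish_space \<Rightarrow> 'th \<Rightarrow> real) \<Rightarrow>
   ('th \<Rightarrow> 't measure) \<Rightarrow> ('th \<Rightarrow> 't \<Rightarrow> bool \<Rightarrow> 'x measure) \<Rightarrow> ('th \<Rightarrow> 'x measure) \<Rightarrow> bool" where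
  "canonically_implements u \<pi> t g f \<longleftrightarrow>
     (\<exists>r a. (\<forall>\<theta>. r \<theta> = return borel \<theta>)
        \<and> (\<forall>\<theta>. \<forall>\<tau> \<in> msupport (t \<theta>). a \<theta> \<theta> \<tau> = 1)
        \<and> best_response u \<pi> t g r a
        \<and> (\<forall>\<theta>. decision_law \<pi> t g r a \<theta> = f \<theta>))"

definition more_discerning :: "('t \<Rightarrow> 'th \<Rightarrow> real) \<Rightarrow> 'th \<Rightarrow> 't \<Rightarrow> 't \<Rightarrow> bool" where
  "more_discerning \<pi> \<theta> \<tau> \<psi> \<longleftrightarrow>
     (\<exists>k0 \<in> {0..1}. \<exists>k1 \<in> {0..1}. k0 \<le> k1
        \<and> \<pi> \<tau> \<theta> * k1 + (1 - \<pi> \<tau> \<theta>) * k0 = \<pi> \<psi> \<theta>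
        \<and> (\<forall>\<theta>'. \<theta>' \<noteq> \<theta> \<longrightarrow> \<pi> \<tau> \<theta>' * k1 + (1 - \<pi> \<tau> \<theta>') * k0 \<le> \<pi> \<psi> \<theta>'))"

end

theory Submission
  imports Defs
begin

text \<open>
  In the new mechanism a report \<open>\<theta>\<close> is tested with \<open>\<tau>\<close>, and the score \<open>s\<close> on \<open>\<tau>\<close> is converted into
  a score on \<open>\<psi>\<close> that is a pass with probability \<open>k\<^sub>s\<close>. If type \<open>\<theta>\<^sub>1\<close> reports \<open>\<theta>\<close> and tries with
  probability \<open>\<alpha>\<close>, the converted score is a pass with probability
  \<open>\<alpha> \<pi>(\<tau>|\<theta>\<^sub>1) k\<^sub>1 + (1 - \<alpha> \<pi>(\<tau>|\<theta>\<^sub>1)) k\<^sub>0 \<le> \<pi>(\<psi>|\<theta>\<^sub>1)\<close>, a pass probability that he could already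
  achieve in the old mechanism by trying on \<open>\<psi>\<close> less often. So every deviation in the new mechanism
  has a counterpart with the same decision law in the old one, while truthful type \<open>\<theta>\<close> passes with
  the same probability as before.
\<close>

section \<open>Universal measurability and completed point masses\<close>

lemma space_universal_completion [simp]: "space (universal_completion M) = space M"
  unfolding universal_completion_def by (rule space_measure_of) auto

lemma sets_universal_completion:
  "sets (universal_completion M) = sigma_sets (space M)
     {A. A \<subseteq> space M \<and> (\<forall>\<mu>. prob_space \<mu> \<and> sets \<mu> = sets M \<longrightarrow> A \<in> sets (completion \<mu>))}"
  unfolding universal_completion_def by (rule sets_measure_of) auto

lemma sets_universal_completionI:
  "A \<in> sets M \<Longrightarrow> A \<in> sets (universal_completion M)"
  unfolding sets_universal_completion
  by (rule sigma_sets.Basic) (auto dest: sets.sets_into_space)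

lemma measurable_universal_completionI:
  assumes f: "f \<in> M \<rightarrow>\<^sub>M N"
  shows "f \<in> universal_completion M \<rightarrow>\<^sub>M N"
  using f by (auto intro!: measurableI sets_universal_completionI dest: measurable_space
      simp: measurable_sets)

text \<open>A probability measure on \<open>M\<close> pushes forward to one on \<open>N\<close>,
  whose completion contains \<open>A\<close>; null sets of the pushforward have null preimages, so
  \<open>f\<close> stays measurable after both measures are completed. This allows a Borel map to be
  substituted into a universally measurable function.\<close>

lemma measurable_universal_completion2:
  assumes f: "f \<in> M \<rightarrow>\<^sub>M N"
  shows "f \<in> universal_completion M \<rightarrow>\<^sub>M universal_completion N"
proof (rule measurable_sigma_sets[OF sets_universal_completion])
  show "f \<in> space (universal_completion M) \<rightarrow> space N"
    using f by (auto dest: measurable_space)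
next
  fix A
  assume "A \<in> {A. A \<subseteq> space N \<and>
    (\<forall>\<mu>. prob_space \<mu> \<and> sets \<mu> = sets N \<longrightarrow> A \<in> sets (completion \<mu>))}"
  then have A: "A \<in> sets (completion \<nu>)" if "prob_space \<nu>" "sets \<nu> = sets N" for \<nu>
    using that by blast
  have "f -` A \<inter> space M \<in> sets (completion \<mu>)" if \<mu>: "prob_space \<mu>" "sets \<mu> = sets M" for \<mu>
  proof -
    have f\<mu>: "f \<in> \<mu> \<rightarrow>\<^sub>M N"
      using f measurable_cong_sets[OF \<mu>(2) refl] by blast
    have "f \<in> completion \<mu> \<rightarrow>\<^sub>M completion (distr \<mu> N f)"
      by (rule completion.measurable_completion2)
        (use f\<mu> in \<open>auto simp: null_sets_distr_iff null_sets_completionI measurable_completion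
            null_sets_def emeasure_distr\<close>)
    moreover have "A \<in> sets (completion (distr \<mu> N f))"
      using prob_space.prob_space_distr[OF \<mu>(1) f\<mu>] by (intro A) auto
    ultimately have "f -` A \<inter> space (completion \<mu>) \<in> sets (completion \<mu>)"
      by (rule measurable_sets)
    then show ?thesis
      by (simp add: sets_eq_imp_space_eq[OF \<mu>(2)])
  qed
  then show "f -` A \<inter> space (universal_completion M) \<in> sets (universal_completion M)"
    unfolding sets_universal_completion
    by (intro sigma_sets.Basic) auto
qed auto

text \<open>Points are closed in a T1 space, so the complement of \<open>y\<close> is null and every
  set becomes measurable in the completed point mass.\<close>

lemma emeasure_completion_return:
  fixes y :: "'a::t1_space"
  shows "emeasure (completion (return borel y)) A = indicator A y"
proof -
  have null: "- {y} \<in> null_sets (return borel y)"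
    by (auto simp: null_sets_def)
  have A: "A \<in> sets (completion (return borel y))"
    by (rule sets_completionI[of _ "A \<inter> {y}" "A - {y}" "- {y}"])
      (use null in \<open>auto simp: Int_insert_right\<close>)
  have AE: "AE x in completion (return borel y). x = y"
    using null_sets_completionI[OF null] by (rule AE_I') auto
  have "emeasure (completion (return borel y)) A
      = emeasure (completion (return borel y)) (if y \<in> A then UNIV else {})"
    by (rule emeasure_eq_AE) (use AE A in auto)
  then show ?thesis
    by (auto simp: emeasure_completion)
qed

text \<open>
  Since \<^const>\<open>distr\<close> is given by its values on sets, the kernels need not be measurable here.
\<close>
lemma bind_completion_return_cong:
  fixes y y' :: "'a::t1_space"
  assumes eq: "F y = F' y'"
    and F: "\<And>x. sets (F x) = sets N" and F': "\<And>x. sets (F' x) = sets N"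
  shows "Giry_Monad.bind (completion (return borel y)) F
    = Giry_Monad.bind (completion (return borel y')) F'"
proof -
  \<comment> \<open>\<open>Giry_Monad.bind\<close> reads its target algebra off the value of
    \<open>G\<close> at an arbitrarily chosen point; since all values have the sets of
    \<open>N\<close>, the choice does not matter.\<close>
  have bind: "Giry_Monad.bind (completion (return borel z)) G
      = join (distr (completion (return borel z)) (subprob_algebra N) G)"
    if "\<And>x. sets (G x) = sets N" for z :: 'a and G
    by (subst bind_nonempty) (use subprob_algebra_cong[OF that] in auto)
  have "distr (completion (return borel y)) (subprob_algebra N) F
      = distr (completion (return borel y')) (subprob_algebra N) F'"
    unfolding distr_def
    by (rule measure_of_eq)
      (auto simp: emeasure_completion_return eq indicator_def dest: sets.sets_into_space)
  then show ?thesis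
    by (simp add: bind F F')
qed

section \<open>Composition of random scores\<close>

lemma bind_bernoulli_pmf:
  assumes "p \<in> {0..1}" "k0 \<in> {0..1}" "k1 \<in> {0..1}"
  shows "bind_pmf (bernoulli_pmf p) (\<lambda>s. bernoulli_pmf (if s then k1 else k0))
    = bernoulli_pmf (p * k1 + (1 - p) * k0)"
proof (rule pmf_eqI)
  fix b
  \<comment> \<open>\<open>bernoulli_pmf\<close> clamps its parameter to the unit interval, so the
    convex combination must be shown to lie there.\<close>
  have "p * k1 + (1 - p) * k0 \<le> p * 1 + (1 - p) * 1"
    using assms by (intro add_mono mult_left_mono) auto
  moreover have "0 \<le> p * k1 + (1 - p) * k0"
    using assms by (intro add_nonneg_nonneg mult_nonneg_nonneg) auto
  ultimately show "pmf (bind_pmf (bernoulli_pmf p) (\<lambda>s. bernoulli_pmf (if s then k1 else k0))) b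
    = pmf (bernoulli_pmf (p * k1 + (1 - p) * k0)) b"
    using assms by (cases b) (auto simp: pmf_bind algebra_simps)
qed

lemma bind_measure_pmf_prob_algebra:
  assumes "\<And>x. h x \<in> space (prob_algebra N)"
  shows "Giry_Monad.bind (measure_pmf p) h \<in> space (prob_algebra N)"
proof -
  have "h \<in> measure_pmf p \<rightarrow>\<^sub>M prob_algebra N"
    using assms by (auto simp: measurable_def)
  moreover have "measure_pmf p \<in> space (prob_algebra (measure_pmf p))"
    by (simp add: space_prob_algebra measure_pmf.prob_space_axioms)
  ultimately show ?thesis
    using sets_bind'[of "measure_pmf p" "measure_pmf p" h N]
      prob_space_bind'[of "measure_pmf p" "measure_pmf p" h N]
    by (simp add: space_prob_algebra)
qed

lemma sets_bind_measure_pmf: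
  assumes "\<And>x. h x \<in> space (prob_algebra N)"
  shows "sets (Giry_Monad.bind (measure_pmf p) h) = sets N"
  using bind_measure_pmf_prob_algebra[of h N p, OF assms] by (simp add: space_prob_algebra)

text \<open>Associativity of bind merges the two coin tosses before \<open>h\<close> is applied.
  This is how a randomly converted score on one test replaces a score on another.\<close>

lemma bind_bernoulli_mixture:
  assumes "p \<in> {0..1}" "k0 \<in> {0..1}" "k1 \<in> {0..1}"
    and h: "\<And>b. h b \<in> space (prob_algebra N)"
  shows "Giry_Monad.bind (measure_pmf (bernoulli_pmf p))
      (\<lambda>s. Giry_Monad.bind (measure_pmf (bernoulli_pmf (if s then k1 else k0))) h)
    = Giry_Monad.bind (measure_pmf (bernoulli_pmf (p * k1 + (1 - p) * k0))) h"
proof -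
  have "h \<in> count_space UNIV \<rightarrow>\<^sub>M subprob_algebra N"
    by (rule measurable_prob_algebraD) (use h in \<open>auto simp: measurable_def\<close>)
  then show ?thesis
    by (subst bind_bernoulli_pmf[OF assms(1-3), symmetric], unfold measure_pmf_bind,
        subst bind_assoc[where N = "count_space UNIV" and R = N])
      (auto simp: space_subprob_algebra intro!: prob_space_imp_subprob_space measure_pmf.prob_space_axioms)
qed

section \<open>Laws conditional on the report\<close>

lemma univ_kernel_prob_algebra:
  "univ_kernel k \<Longrightarrow> k y \<in> space (prob_algebra borel)"
  unfolding univ_kernel_def by (drule measurable_space[where x = y]) auto

lemma msupport_return: "y \<in> msupport (return borel y)"
  by (auto simp: msupport_def)

text \<open>Two mechanisms can be compared report by report at this level: if these laws agree at
  every report, the decision laws agree under any reporting rule.\<close>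

definition report_law ::
  "('t::polish_space \<Rightarrow> 'th::polish_space \<Rightarrow> real) \<Rightarrow>
   ('th \<Rightarrow> 't measure) \<Rightarrow> ('th \<Rightarrow> 't \<Rightarrow> bool \<Rightarrow> 'x::polish_space measure) \<Rightarrow>
   ('th \<Rightarrow> 'th \<Rightarrow> 't \<Rightarrow> real) \<Rightarrow> 'th \<Rightarrow> 'th \<Rightarrow> 'x measure" where
  "report_law \<pi> t g a \<theta> \<theta>' =
     Giry_Monad.bind (completion (t \<theta>')) (\<lambda>\<tau>.
       Giry_Monad.bind (measure_pmf (bernoulli_pmf (a \<theta> \<theta>' \<tau> * \<pi> \<tau> \<theta>))) (\<lambda>s. g \<theta>' \<tau> s))"

lemma decision_law_eq_bind_report_law:
  "decision_law \<pi> t g r a \<theta>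
    = Giry_Monad.bind (completion (r \<theta>)) (report_law \<pi> t g a \<theta>)"
  unfolding decision_law_def report_law_def ..

lemma mechanism_prob_algebra:
  assumes "canonical_mechanism t g"
  shows "g \<theta>' \<sigma> s \<in> space (prob_algebra borel)" "t \<theta>' \<in> space (prob_algebra borel)"
  using assms univ_kernel_prob_algebra[of "\<lambda>(\<theta>', \<tau>, s). g \<theta>' \<tau> s" "(\<theta>', \<sigma>, s)"]
  by (auto simp: canonical_mechanism_def univ_kernel_prob_algebra)

lemma sets_report_law:
  assumes "canonical_mechanism t g"
  shows "sets (report_law \<pi> t g a \<theta> \<theta>') = sets borel"
proof -
  have "sets (t \<theta>') = sets borel"
    using mechanism_prob_algebra[OF assms] by (simp add: space_prob_algebra)
  then have "space (completion (t \<theta>')) \<noteq> {}"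
    using sets_eq_imp_space_eq[of "t \<theta>'" borel] by simp
  then show ?thesis
    unfolding report_law_def
    using sets_bind_measure_pmf[of "g \<theta>' _", OF mechanism_prob_algebra(1)[OF assms]]
    by (subst sets_bind[where N = borel]) auto
qed

theorem theorem1:
  fixes u :: "'x::polish_space \<Rightarrow> 'th::polish_space \<Rightarrow> real"
    and \<pi> :: "'t::polish_space \<Rightarrow> 'th \<Rightarrow> real"
    and t :: "'th \<Rightarrow> 't measure"
    and g :: "'th \<Rightarrow> 't \<Rightarrow> bool \<Rightarrow> 'x measure"
    and f :: "'th \<Rightarrow> 'x measure"
    and \<theta> :: 'th and \<tau> \<psi> :: 't
  assumes u_measurable: "(\<lambda>(x, \<theta>). u x \<theta>) \<in> borel_measurable borel"
    and u_bounded: "bounded (range (\<lambda>(x, \<theta>). u x \<theta>))"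
    and pi_measurable: "(\<lambda>(\<tau>, \<theta>). \<pi> \<tau> \<theta>) \<in> borel_measurable borel"
    and pi_range: "\<And>\<tau> \<theta>. \<pi> \<tau> \<theta> \<in> {0..1}"
    and discerning: "more_discerning \<pi> \<theta> \<tau> \<psi>"
    and scf: "univ_kernel f"
    and mechanism: "canonical_mechanism t g"
    and implements: "canonically_implements u \<pi> t g f"
    and test: "t \<theta> = return borel \<psi>"
  shows "\<exists>t' g'. canonical_mechanism t' g' \<and> canonically_implements u \<pi> t' g' f
           \<and> t' \<theta> = return borel \<tau>"
proof -
  obtain k0 k1 where k: "k0 \<in> {0..1}" "k1 \<in> {0..1}" "k0 \<le> k1"
    and k_eq: "\<pi> \<tau> \<theta> * k1 + (1 - \<pi> \<tau> \<theta>) * k0 = \<pi> \<psi> \<theta>"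
    and "\<And>\<theta>'. \<theta>' \<noteq> \<theta> \<Longrightarrow> \<pi> \<tau> \<theta>' * k1 + (1 - \<pi> \<tau> \<theta>') * k0 \<le> \<pi> \<psi> \<theta>'"
    using discerning unfolding more_discerning_def by blast
  then have k_le: "\<pi> \<tau> \<theta>' * k1 + (1 - \<pi> \<tau> \<theta>') * k0 \<le> \<pi> \<psi> \<theta>'" for \<theta>'
    by (cases "\<theta>' = \<theta>") auto
  obtain r a where r: "\<And>\<theta>. r \<theta> = return borel \<theta>"
    and a_supp: "\<And>\<theta> \<tau>. \<tau> \<in> msupport (t \<theta>) \<Longrightarrow> a \<theta> \<theta> \<tau> = 1"
    and best: "best_response u \<pi> t g r a"
    and law: "\<And>\<theta>. decision_law \<pi> t g r a \<theta> = f \<theta>"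
    using implements unfolding canonically_implements_def by blast
  have strat: "strategy r a"
    using best unfolding best_response_def by blast
  have a_psi: "a \<theta> \<theta> \<psi> = 1"
    by (rule a_supp) (simp add: test msupport_return)

  \<comment> \<open>The new mechanism\<close>
  define t' where "t' = t(\<theta> := return borel \<tau>)"
  define G where "G s = Giry_Monad.bind
    (measure_pmf (bernoulli_pmf (if s then k1 else k0))) (g \<theta> \<psi>)" for s
  \<comment> \<open>After report \<open>\<theta>\<close> the test shown is ignored, since
    \<open>\<tau>\<close> is drawn almost surely; the rule then takes only the two values
    \<open>G True\<close> and \<open>G False\<close> there.\<close>
  define g' where "g' \<theta>' \<sigma> s = (if \<theta>' = \<theta> then G s else g \<theta>' \<sigma> s)" for \<theta>' \<sigma> s
  \<comment> \<open>Implementation by \<open>(t, g)\<close> forces \<open>a\<close> to be 1 at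
    \<open>\<psi>\<close>, but says nothing about trying on \<open>\<tau>\<close>.\<close>
  define a' where "a' \<theta>\<^sub>1 \<theta>' \<sigma> = (if \<theta>\<^sub>1 = \<theta> \<and> \<theta>' = \<theta> then 1 else a \<theta>\<^sub>1 \<theta>' \<sigma>)" for \<theta>\<^sub>1 \<theta>' \<sigma>

  have g_prob: "g \<theta>' \<sigma> s \<in> space (prob_algebra borel)" for \<theta>' \<sigma> s
    by (rule mechanism_prob_algebra[OF mechanism])
  have G_prob: "G s \<in> space (prob_algebra borel)" for s
    unfolding G_def by (rule bind_measure_pmf_prob_algebra[OF g_prob])

  have mechanism': "canonical_mechanism t' g'"
    unfolding canonical_mechanism_def
  proof
    have t'_If: "t' = (\<lambda>\<theta>'. if \<theta>' \<in> {\<theta>} then return borel \<tau> else t \<theta>')"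
      by (auto simp: t'_def fun_eq_iff)
    have "t \<in> universal_completion borel \<rightarrow>\<^sub>M prob_algebra borel"
      using mechanism unfolding canonical_mechanism_def univ_kernel_def by blast
    then show "univ_kernel t'"
      unfolding univ_kernel_def t'_If
      by (intro measurable_If_set measurable_const sets_universal_completionI)
        (auto simp: space_prob_algebra prob_space_return intro!: sets_universal_completionI)
    \<comment> \<open>The cases are separated by closed sets, so measurability reduces to that of
      constants and of the old rule.\<close>
    have g'_If: "(\<lambda>(\<theta>', \<sigma>, s). g' \<theta>' \<sigma> s) = (\<lambda>x. if x \<in> {\<theta>} \<times> UNIV
        then if x \<in> UNIV \<times> UNIV \<times> {True} then G True else G False
        else (\<lambda>(\<theta>', \<sigma>, s). g \<theta>' \<sigma> s) x)"
      by (auto simp: g'_def fun_eq_iff)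
    have g: "(\<lambda>(\<theta>', \<sigma>, s). g \<theta>' \<sigma> s) \<in> universal_completion borel \<rightarrow>\<^sub>M prob_algebra borel"
      using mechanism unfolding canonical_mechanism_def univ_kernel_def by blast
    have closed: "closed ({\<theta>} \<times> (UNIV :: ('t \<times> bool) set))"
      "closed ((UNIV :: 'th set) \<times> (UNIV :: 't set) \<times> {True})"
      by (intro closed_Times closed_UNIV closed_singleton)+
    show "univ_kernel (\<lambda>(\<theta>', \<sigma>, s). g' \<theta>' \<sigma> s)"
      unfolding univ_kernel_def g'_If
      by (intro measurable_If_set measurable_const g)
        (use closed G_prob in \<open>auto intro!: sets_universal_completionI borel_closed\<close>)
  qed

  text \<open>The function \<open>c b\<close> is the counterpart of \<open>b\<close> in \<open>(t, g)\<close>; where \<open>\<pi>(\<psi>|\<theta>\<^sub>1) = 0\<close> the division gives \<open>0\<close>, as it should.\<close>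
  define p where "p b \<theta>\<^sub>1 = b \<theta>\<^sub>1 \<theta> \<tau> * \<pi> \<tau> \<theta>\<^sub>1 * k1 + (1 - b \<theta>\<^sub>1 \<theta> \<tau> * \<pi> \<tau> \<theta>\<^sub>1) * k0"
    for b :: "'th \<Rightarrow> 'th \<Rightarrow> 't \<Rightarrow> real" and \<theta>\<^sub>1
  define c where "c b \<theta>\<^sub>1 \<theta>' \<sigma> = (if \<theta>' = \<theta> then p b \<theta>\<^sub>1 / \<pi> \<psi> \<theta>\<^sub>1 else b \<theta>\<^sub>1 \<theta>' \<sigma>)"
    for b :: "'th \<Rightarrow> 'th \<Rightarrow> 't \<Rightarrow> real" and \<theta>\<^sub>1 \<theta>' \<sigma>

  \<comment> \<open>Matching deviations with deviations in the old mechanism\<close>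
  have p_range: "0 \<le> p b \<theta>\<^sub>1" "p b \<theta>\<^sub>1 \<le> \<pi> \<psi> \<theta>\<^sub>1" and bpi_range: "b \<theta>\<^sub>1 \<theta> \<tau> * \<pi> \<tau> \<theta>\<^sub>1 \<in> {0..1}"
    if "strategy s b" for s b \<theta>\<^sub>1
  proof -
    have b: "b \<theta>\<^sub>1 \<theta> \<tau> \<in> {0..1}"
      using that unfolding strategy_def by blast
    have le: "b \<theta>\<^sub>1 \<theta> \<tau> * \<pi> \<tau> \<theta>\<^sub>1 \<le> \<pi> \<tau> \<theta>\<^sub>1"
      using b pi_range[of \<tau> \<theta>\<^sub>1] by (auto intro: mult_left_le_one_le)
    then show bpi: "b \<theta>\<^sub>1 \<theta> \<tau> * \<pi> \<tau> \<theta>\<^sub>1 \<in> {0..1}"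
      using b pi_range[of \<tau> \<theta>\<^sub>1] by auto
    then show "0 \<le> p b \<theta>\<^sub>1"
      unfolding p_def using k by (intro add_nonneg_nonneg mult_nonneg_nonneg[where b = k1]
          mult_nonneg_nonneg[where b = k0]) auto
    \<comment> \<open>The converted pass probability is affine in the pass probability on
      \<open>\<tau>\<close> with slope \<open>k1 - k0\<close>, which is nonnegative; trying less can
      only lower it, and \<open>k_le\<close> bounds the case of full effort.\<close>
    have "b \<theta>\<^sub>1 \<theta> \<tau> * \<pi> \<tau> \<theta>\<^sub>1 * (k1 - k0) \<le> \<pi> \<tau> \<theta>\<^sub>1 * (k1 - k0)"
      using le k by (intro mult_right_mono) auto
    then show "p b \<theta>\<^sub>1 \<le> \<pi> \<psi> \<theta>\<^sub>1"
      using k_le[of \<theta>\<^sub>1] unfolding p_def by (simp add: algebra_simps)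
  qed

  \<comment> \<open>If \<open>\<pi> \<psi> \<theta>\<^sub>1 = 0\<close>, then \<open>p_range\<close>
    forces \<open>p b \<theta>\<^sub>1 = 0\<close>, so the product is correct despite the division
    by zero.\<close>
  have c_mult: "c b \<theta>\<^sub>1 \<theta> \<psi> * \<pi> \<psi> \<theta>\<^sub>1 = p b \<theta>\<^sub>1" if "strategy s b" for s b \<theta>\<^sub>1
    using p_range[OF that, of \<theta>\<^sub>1] by (auto simp: c_def)

  have c_strategy: "strategy s (c b)" if sb: "strategy s b" for s b
    unfolding strategy_def
  proof (intro conjI allI)
    show "univ_kernel s"
      using sb unfolding strategy_def by blast
    have b: "(\<lambda>(\<theta>\<^sub>1, \<theta>', \<sigma>). b \<theta>\<^sub>1 \<theta>' \<sigma>) \<in> universal_completion borel \<rightarrow>\<^sub>M borel"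
      using sb unfolding strategy_def by blast
    \<comment> \<open>Fixing report and test in \<open>b\<close> is composition with a continuous
      section, which is measurable between the universal completions.\<close>
    have "(\<lambda>x::'th \<times> 'th \<times> 't. (fst x, \<theta>, \<tau>)) \<in> borel \<rightarrow>\<^sub>M borel"
      by (intro borel_measurable_continuous_onI continuous_intros)
    from measurable_compose[OF measurable_universal_completion2[OF this] b]
    have b\<theta>: "(\<lambda>x::'th \<times> 'th \<times> 't. b (fst x) \<theta> \<tau>) \<in> universal_completion borel \<rightarrow>\<^sub>M borel"
      by simp
    have pi: "(\<lambda>x::'th \<times> 'th \<times> 't. \<pi> \<sigma> (fst x)) \<in> universal_completion borel \<rightarrow>\<^sub>M borel" for \<sigma>
    proof -
      have "(\<lambda>x::'th \<times> 'th \<times> 't. (\<sigma>, fst x)) \<in> borel \<rightarrow>\<^sub>M borel"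
        by (intro borel_measurable_continuous_onI continuous_intros)
      from measurable_universal_completionI[OF measurable_compose[OF this pi_measurable]]
      show ?thesis by simp
    qed
    have c_If: "(\<lambda>(\<theta>\<^sub>1, \<theta>', \<sigma>). c b \<theta>\<^sub>1 \<theta>' \<sigma>) = (\<lambda>x. if x \<in> UNIV \<times> {\<theta>} \<times> UNIV
        then p b (fst x) / \<pi> \<psi> (fst x) else (\<lambda>(\<theta>\<^sub>1, \<theta>', \<sigma>). b \<theta>\<^sub>1 \<theta>' \<sigma>) x)"
      by (auto simp: c_def fun_eq_iff)
    have "closed ((UNIV :: 'th set) \<times> {\<theta>} \<times> (UNIV :: 't set))"
      by (intro closed_Times closed_UNIV closed_singleton)
    then show "(\<lambda>(\<theta>\<^sub>1, \<theta>', \<sigma>). c b \<theta>\<^sub>1 \<theta>' \<sigma>) \<in> universal_completion borel \<rightarrow>\<^sub>M borel"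
      unfolding c_If p_def
      by (intro measurable_If_set b borel_measurable_divide borel_measurable_add
          borel_measurable_times borel_measurable_diff b\<theta> pi borel_measurable_const)
        (auto intro!: sets_universal_completionI borel_closed)
    show "c b \<theta>\<^sub>1 \<theta>' \<sigma> \<in> {0..1}" for \<theta>\<^sub>1 \<theta>' \<sigma>
      using sb p_range[OF sb, of \<theta>\<^sub>1] pi_range[of \<psi> \<theta>\<^sub>1]
      by (auto simp: c_def strategy_def intro!: divide_nonneg_nonneg divide_le_eq_1[THEN iffD2])
  qed

  have test_law: "Giry_Monad.bind (measure_pmf (bernoulli_pmf (b \<theta>\<^sub>1 \<theta> \<tau> * \<pi> \<tau> \<theta>\<^sub>1))) (g' \<theta> \<tau>)
      = Giry_Monad.bind (measure_pmf (bernoulli_pmf (p b \<theta>\<^sub>1))) (g \<theta> \<psi>)"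
    if "strategy s b" for s b \<theta>\<^sub>1
    using bind_bernoulli_mixture[OF bpi_range[OF that] k(1,2) g_prob]
    by (simp add: g'_def[abs_def] G_def p_def)

  \<comment> \<open>Both testing rules are point masses at \<open>\<theta>\<close>, so only the laws
    at \<open>\<tau>\<close> and \<open>\<psi>\<close> have to agree. A general \<open>b'\<close>
    covers both the counterpart \<open>c b\<close> and the truthful strategy
    \<open>a\<close>.\<close>
  have report_at_\<theta>: "report_law \<pi> t' g' b \<theta>\<^sub>1 \<theta> = report_law \<pi> t g b' \<theta>\<^sub>1 \<theta>"
    if sb: "strategy s b" and b': "b' \<theta>\<^sub>1 \<theta> \<psi> * \<pi> \<psi> \<theta>\<^sub>1 = p b \<theta>\<^sub>1" for s b b' \<theta>\<^sub>1
  proof -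
    show ?thesis
      unfolding report_law_def t'_def test fun_upd_same
      by (rule bind_completion_return_cong[where N = borel])
        (auto simp: test_law[OF sb] b' g_prob mechanism_prob_algebra[OF mechanism']
          intro!: sets_bind_measure_pmf simp del: sets_bind)
  qed

  have counterpart: "decision_law \<pi> t' g' s b \<theta>\<^sub>1 = decision_law \<pi> t g s (c b) \<theta>\<^sub>1"
    if sb: "strategy s b" for s b \<theta>\<^sub>1
  proof -
    have "report_law \<pi> t' g' b \<theta>\<^sub>1 \<theta>' = report_law \<pi> t g (c b) \<theta>\<^sub>1 \<theta>'" for \<theta>'
    proof (cases "\<theta>' = \<theta>")
      case True
      then show ?thesis
        using report_at_\<theta>[of s b "c b" \<theta>\<^sub>1, OF sb c_mult[OF sb]] by simp
    next
      case False
      then show ?thesis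
        by (simp add: report_law_def t'_def g'_def c_def)
    qed
    then have "report_law \<pi> t' g' b \<theta>\<^sub>1 = report_law \<pi> t g (c b) \<theta>\<^sub>1"
      by blast
    then show ?thesis
      by (simp add: decision_law_eq_bind_report_law)
  qed

  \<comment> \<open>Truthful play in the new mechanism\<close>
  have strat': "strategy r a'"
    unfolding strategy_def
  proof (intro conjI allI)
    show "univ_kernel r"
      using strat unfolding strategy_def by blast
    have a: "(\<lambda>(\<theta>\<^sub>1, \<theta>', \<sigma>). a \<theta>\<^sub>1 \<theta>' \<sigma>) \<in> universal_completion borel \<rightarrow>\<^sub>M borel"
      using strat unfolding strategy_def by blast
    have a'_If: "(\<lambda>(\<theta>\<^sub>1, \<theta>', \<sigma>). a' \<theta>\<^sub>1 \<theta>' \<sigma>) = (\<lambda>x. if x \<in> {\<theta>} \<times> {\<theta>} \<times> UNIV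
        then 1 else (\<lambda>(\<theta>\<^sub>1, \<theta>', \<sigma>). a \<theta>\<^sub>1 \<theta>' \<sigma>) x)"
      by (auto simp: a'_def fun_eq_iff)
    have "closed ({\<theta>} \<times> {\<theta>} \<times> (UNIV :: 't set))"
      by (intro closed_Times closed_UNIV closed_singleton)
    then show "(\<lambda>(\<theta>\<^sub>1, \<theta>', \<sigma>). a' \<theta>\<^sub>1 \<theta>' \<sigma>) \<in> universal_completion borel \<rightarrow>\<^sub>M borel"
      unfolding a'_If
      by (intro measurable_If_set a borel_measurable_const)
        (auto intro!: sets_universal_completionI borel_closed)
    show "a' \<theta>\<^sub>1 \<theta>' \<sigma> \<in> {0..1}" for \<theta>\<^sub>1 \<theta>' \<sigma>
      using strat by (auto simp: a'_def strategy_def)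
  qed

  have law': "decision_law \<pi> t' g' r a' \<theta>\<^sub>1 = decision_law \<pi> t g r a \<theta>\<^sub>1" for \<theta>\<^sub>1
  proof -
    \<comment> \<open>Reports are truthful, so only the law at the type's own report enters. For
      type \<open>\<theta>\<close> full effort on \<open>\<tau>\<close> reproduces
      \<open>\<pi> \<psi> \<theta>\<close> exactly, by \<open>k_eq\<close>.\<close>
    have "report_law \<pi> t' g' a' \<theta>\<^sub>1 \<theta>\<^sub>1 = report_law \<pi> t g a \<theta>\<^sub>1 \<theta>\<^sub>1"
    proof (cases "\<theta>\<^sub>1 = \<theta>")
      case True
      have "a \<theta> \<theta> \<psi> * \<pi> \<psi> \<theta> = p a' \<theta>"
        using k_eq by (simp add: p_def a'_def a_psi)
      from report_at_\<theta>[of r a' a \<theta>, OF strat' this] True show ?thesis by simp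
    next
      case False
      then show ?thesis
        by (simp add: report_law_def t'_def g'_def a'_def)
    qed
    then show ?thesis
      unfolding decision_law_eq_bind_report_law r
      by (rule bind_completion_return_cong)
        (rule sets_report_law[OF mechanism'] sets_report_law[OF mechanism])+
  qed

  \<comment> \<open>A deviation \<open>b\<close> under any reporting rule yields what
    \<open>c b\<close> yields in \<open>(t, g)\<close>, hence at most the old truthful payoff, which
    \<open>law'\<close> identifies with the new one.\<close>
  have "best_response u \<pi> t' g' r a'"
    using best strat' c_strategy
    by (simp add: best_response_def expected_utility_def counterpart law')
  moreover have "a' \<theta>\<^sub>1 \<theta>\<^sub>1 \<sigma> = 1" if "\<sigma> \<in> msupport (t' \<theta>\<^sub>1)" for \<theta>\<^sub>1 \<sigma>
    using that a_supp by (auto simp: a'_def t'_def split: if_splits)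
  ultimately have "canonically_implements u \<pi> t' g' f"
    unfolding canonically_implements_def using r law law' by metis
  moreover have "t' \<theta> = return borel \<tau>"
    by (simp add: t'_def)
  ultimately show ?thesis
    using mechanism' by blast
qed

end
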